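(* There exist compact spaces which do not admit local compensation.
   Context: A compact space is a compact Hausdorff topological space. For a compact space $K$, $\mathcal{M}(K)=C(K)^*$ is the space of regular Borel signed (real) measures on $K$ with the total variation norm, $B_{\mathcal{M}(K)}$ is its closed unit ball, $\omega^*$ its weak$^*$ topology, and $\mu^+$ is the positive part of $\mu\in\mathcal{M}(K)$. $\nu\in\mathcal{M}(K)$ is a compensation of $\mu\in\mathcal{M}(K)$ if: $0\le\nu\le\mu^+$ and $\nu(K)=\mu(K)$ in case $\mu(K)>0$; and $\nu=0$ in case $\mu(K)\le 0$. $W(K)$ is the set of all $\omega^*$-continuous functions $F\colon K\to B_{\mathcal{M}(K)}$. $G\in W(K)$ is a compensation of $F\in W(K)$ if $G(t)$ is a compensation of $F(t)$ for every $t\in K$. $K$ admits local compensation if every element of $W(K)$ admits a compensation (in $W(K)$). *)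

theory Defs
  imports "HOL-Analysis.Analysis"
begin

abbreviation borel_sets :: "'a topology \<Rightarrow> 'a set set" where
  "borel_sets X \<equiv> sigma_sets (topspace X) {U. openin X U}"

(* Convergence is demanded for every enumeration of the union, hence is absolute;
   the empty set gets value 0 because the constant sequence {} must be summable. *)
definition signed_borel_measure :: "'a topology \<Rightarrow> ('a set \<Rightarrow> real) \<Rightarrow> bool" where
  "signed_borel_measure X \<mu> \<longleftrightarrow>
     (\<forall>A :: nat \<Rightarrow> 'a set. range A \<subseteq> borel_sets X \<and> disjoint_family A \<longrightarrow>
        (\<lambda>i. \<mu> (A i)) sums \<mu> (\<Union>i. A i))"

(* Meaningful for Borel sets E. A real-valued signed measure has finite total variation,
   so the supremum is over a bounded set. *)
definition variation :: "'a topology \<Rightarrow> ('a set \<Rightarrow> real) \<Rightarrow> 'a set \<Rightarrow> real" where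
  "variation X \<mu> E =
     Sup {\<Sum>A\<in>P. \<bar>\<mu> A\<bar> | P. finite P \<and> partition_on E P \<and> P \<subseteq> borel_sets X}"

(* Jordan decomposition of a signed measure. *)
definition pos_part :: "'a topology \<Rightarrow> ('a set \<Rightarrow> real) \<Rightarrow> 'a set \<Rightarrow> real" where
  "pos_part X \<mu> E = (variation X \<mu> E + \<mu> E) / 2"

definition neg_part :: "'a topology \<Rightarrow> ('a set \<Rightarrow> real) \<Rightarrow> 'a set \<Rightarrow> real" where
  "neg_part X \<mu> E = (variation X \<mu> E - \<mu> E) / 2"

definition regular_measure :: "'a topology \<Rightarrow> ('a set \<Rightarrow> real) \<Rightarrow> bool" where
  "regular_measure X \<mu> \<longleftrightarrow>
     (\<forall>E\<in>borel_sets X. \<forall>\<epsilon>>0. \<exists>C U. compactin X C \<and> openin X U \<and> C \<subseteq> E \<and> E \<subseteq> U \<and>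
        variation X \<mu> (U - C) < \<epsilon>)"

(* A measure is a total function on sets, normalised to 0 off the Borel sets, so that
   equality of functions is equality of measures. *)
definition measure_space_M :: "'a topology \<Rightarrow> ('a set \<Rightarrow> real) set" where
  "measure_space_M X =
     {\<mu>. signed_borel_measure X \<mu> \<and> regular_measure X \<mu> \<and> (\<forall>E. E \<notin> borel_sets X \<longrightarrow> \<mu> E = 0)}"

definition unit_ball_M :: "'a topology \<Rightarrow> ('a set \<Rightarrow> real) set" where
  "unit_ball_M X = {\<mu> \<in> measure_space_M X. variation X \<mu> (topspace X) \<le> 1}"

definition signed_integral :: "'a topology \<Rightarrow> ('a set \<Rightarrow> real) \<Rightarrow> ('a \<Rightarrow> real) \<Rightarrow> real" where
  "signed_integral X \<mu> f =
     integral\<^sup>L (measure_of (topspace X) {U. openin X U} (\<lambda>E. ennreal (pos_part X \<mu> E))) f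
     - integral\<^sup>L (measure_of (topspace X) {U. openin X U} (\<lambda>E. ennreal (neg_part X \<mu> E))) f"

(* The initial topology induced by the functionals given by integration of the continuous
   real functions on X, i.e. by the pairing identifying M(X) with the dual of C(X). *)
definition weak_star_topology :: "'a topology \<Rightarrow> ('a set \<Rightarrow> real) topology" where
  "weak_star_topology X =
     pullback_topology (measure_space_M X)
       (\<lambda>\<mu>. \<lambda>f\<in>{f. continuous_map X euclideanreal f}. signed_integral X \<mu> f)
       (product_topology (\<lambda>f. euclideanreal) {f. continuous_map X euclideanreal f})"

definition is_compensation ::
    "'a topology \<Rightarrow> ('a set \<Rightarrow> real) \<Rightarrow> ('a set \<Rightarrow> real) \<Rightarrow> bool" where
  "is_compensation X \<nu> \<mu> \<longleftrightarrow>
     \<nu> \<in> measure_space_M X \<and>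
     (if \<mu> (topspace X) > 0
      then (\<forall>E\<in>borel_sets X. 0 \<le> \<nu> E \<and> \<nu> E \<le> pos_part X \<mu> E) \<and> \<nu> (topspace X) = \<mu> (topspace X)
      else \<nu> = (\<lambda>E. 0))"

definition W :: "'a topology \<Rightarrow> ('a \<Rightarrow> 'a set \<Rightarrow> real) set" where
  "W X = {F. continuous_map X (subtopology (weak_star_topology X) (unit_ball_M X)) F}"

definition admits_local_compensation :: "'a topology \<Rightarrow> bool" where
  "admits_local_compensation X \<longleftrightarrow>
     (\<forall>F\<in>W X. \<exists>G\<in>W X. \<forall>t\<in>topspace X. is_compensation X (G t) (F t))"

end

(* Let K be the product of the one-point compactifications of a countable and of an uncountable
   discrete space, with points at infinity written oo, and put
   F(a, b) = (delta_(a,oo) + delta_(oo,b) - delta_(oo,oo)) / 3.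
   At a point (n, b) with both coordinates isolated, a compensation of F has the form
   alpha delta_(n,oo) + beta delta_(oo,b) with alpha + beta = 1/3, while at (n, oo) and (oo, b) it is
   forced to be delta_(n,oo) / 3 and delta_(oo,b) / 3.  Continuity therefore gives, for each n,
   alpha > 1/6 for all but finitely many b, and, for each b, beta > 1/6 for all but finitely many n.
   As there are uncountably many b, some b has alpha > 1/6 for every n, contradicting the latter. *)

theory Submission
  imports Defs
begin

section \<open>Finitely supported measures\<close>

text \<open>This is the sum of \<open>c x\<close> times the Dirac measure at \<open>x\<close>, over
  \<open>x\<close> in \<open>S\<close>. The value 0 off the Borel sets is the normalisation used in
  \<open>measure_space_M\<close>, so equal measures are equal functions.\<close>

definition atomic_measure :: "'a topology \<Rightarrow> 'a set \<Rightarrow> ('a \<Rightarrow> real) \<Rightarrow> 'a set \<Rightarrow> real" where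
  "atomic_measure X S c E = (if E \<in> borel_sets X then \<Sum>x\<in>S \<inter> E. c x else 0)"

section \<open>Borel sets of a topology\<close>

lemma openin_subset_Pow: "{U. openin X U} \<subseteq> Pow (topspace X)"
  by (auto dest: openin_subset)

lemma sigma_algebra_borel_sets: "sigma_algebra (topspace X) (borel_sets X)"
  by (rule sigma_algebra_sigma_sets[OF openin_subset_Pow])

lemma borel_sets_subset: "E \<in> borel_sets X \<Longrightarrow> E \<subseteq> topspace X"
  by (rule sigma_sets_into_sp[OF openin_subset_Pow])

lemma openin_borel_sets: "openin X U \<Longrightarrow> U \<in> borel_sets X"
  by (auto intro: sigma_sets.Basic)

lemma Diff_borel_sets: "A \<in> borel_sets X \<Longrightarrow> B \<in> borel_sets X \<Longrightarrow> A - B \<in> borel_sets X"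
  by (meson algebra.axioms(1) ring_of_sets.Diff sigma_algebra.axioms(1) sigma_algebra_borel_sets)

lemma finite_borel_sets:
  assumes "t1_space X" "finite T" "T \<subseteq> topspace X"
  shows "T \<in> borel_sets X"
proof -
  have "closedin X T" using assms t1_space_closedin_finite by blast
  then have "openin X (topspace X - T)" by blast
  then have "topspace X - (topspace X - T) \<in> borel_sets X"
    by (intro sigma_sets.Compl openin_borel_sets)
  then show ?thesis using assms(3) by (simp add: double_diff)
qed

text \<open>Each atom lies in at most one \<open>A i\<close>, so its indicators along the sequence
  sum to the indicator of the union. The claim is a finite linear combination of these
  series.\<close>

lemma atomic_measure_sums:
  fixes c :: "'a \<Rightarrow> real"
  assumes "finite S" "disjoint_family A"
  shows "(\<lambda>i. \<Sum>x\<in>S \<inter> A i. c x) sums (\<Sum>x\<in>S \<inter> (\<Union>i. A i). c x)"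
proof -
  have eq: "(\<Sum>x\<in>S \<inter> E. c x) = (\<Sum>x\<in>S. c x * indicator E x)" for E
    using assms(1) by (simp add: sum.inter_restrict indicator_def of_bool_def if_distrib cong: if_cong)
  show ?thesis
    unfolding eq using assms
    by (intro sums_sum sums_mult indicator_sums) (auto simp: disjoint_family_on_def)
qed

lemma signed_borel_measure_atomic:
  assumes "finite S"
  shows "signed_borel_measure X (atomic_measure X S c)"
  unfolding signed_borel_measure_def
proof (intro allI impI)
  fix A :: "nat \<Rightarrow> 'a set"
  assume A: "range A \<subseteq> borel_sets X \<and> disjoint_family A"
  then have "(\<Union>i. A i) \<in> borel_sets X" by (intro sigma_sets.Union) auto
  moreover have "A i \<in> borel_sets X" for i using A by auto
  ultimately show "(\<lambda>i. atomic_measure X S c (A i)) sums atomic_measure X S c (\<Union>i. A i)"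
    using atomic_measure_sums[OF assms, of A c] A by (simp add: atomic_measure_def)
qed

text \<open>A partition of \<open>E\<close> distributes the atoms among its cells, so the triangle
  inequality bounds every partition sum; a partition that isolates each atom attains the
  bound.\<close>

lemma variation_atomic:
  assumes t1: "t1_space X" and S: "finite S" "S \<subseteq> topspace X" and E: "E \<in> borel_sets X"
  shows "variation X (atomic_measure X S c) E = (\<Sum>x\<in>S \<inter> E. \<bar>c x\<bar>)"
proof -
  let ?\<mu> = "atomic_measure X S c"
  let ?V = "{\<Sum>A\<in>P. \<bar>?\<mu> A\<bar> | P. finite P \<and> partition_on E P \<and> P \<subseteq> borel_sets X}"
  have upper: "(\<Sum>A\<in>P. \<bar>?\<mu> A\<bar>) \<le> (\<Sum>x\<in>S \<inter> E. \<bar>c x\<bar>)"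
    if P: "finite P" "partition_on E P" "P \<subseteq> borel_sets X" for P
  proof -
    have "(\<Sum>A\<in>P. \<bar>?\<mu> A\<bar>) \<le> (\<Sum>A\<in>P. \<Sum>x\<in>S \<inter> A. \<bar>c x\<bar>)"
      using P(3) by (intro sum_mono) (auto simp: atomic_measure_def)
    also have "\<dots> = sum (\<lambda>x. \<bar>c x\<bar>) (\<Union>A\<in>P. S \<inter> A)"
    proof (rule sum.UNION_disjoint[symmetric])
      show "\<forall>A\<in>P. \<forall>B\<in>P. A \<noteq> B \<longrightarrow> (S \<inter> A) \<inter> (S \<inter> B) = {}"
        using partition_onD2[OF P(2)] unfolding disjoint_def by blast
    qed (use P(1) S(1) in auto)
    also have "(\<Union>A\<in>P. S \<inter> A) = S \<inter> E"
      using partition_onD1[OF P(2)] by auto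
    finally show ?thesis .
  qed
  \<comment> \<open>The remainder \<open>E - S\<close> may be empty, and \<open>partition_on\<close>
    forbids empty cells.\<close>
  let ?P = "((\<lambda>x. {x}) ` (S \<inter> E) \<union> {E - S}) - {{}}"
  have fin: "finite ?P" using S by auto
  have part: "partition_on E ?P" by (rule partition_onI) (auto simp: disjnt_def)
  have "{x} \<in> borel_sets X" if "x \<in> S" for x
    using finite_borel_sets[OF t1, of "{x}"] that S by auto
  then have sub: "?P \<subseteq> borel_sets X"
    using Diff_borel_sets[OF E finite_borel_sets[OF t1 S]] by auto
  have "(\<Sum>x\<in>S \<inter> E. \<bar>c x\<bar>) = (\<Sum>A\<in>(\<lambda>x. {x}) ` (S \<inter> E). \<bar>?\<mu> A\<bar>)"
    using \<open>\<And>x. x \<in> S \<Longrightarrow> {x} \<in> borel_sets X\<close>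
    by (subst sum.reindex) (auto simp: atomic_measure_def intro!: sum.cong)
  also have "\<dots> \<le> (\<Sum>A\<in>?P. \<bar>?\<mu> A\<bar>)"
    by (rule sum_mono2[OF fin]) auto
  finally have le: "(\<Sum>x\<in>S \<inter> E. \<bar>c x\<bar>) \<le> (\<Sum>A\<in>?P. \<bar>?\<mu> A\<bar>)" .
  have mem: "(\<Sum>A\<in>?P. \<bar>?\<mu> A\<bar>) \<in> ?V" using fin part sub by blast
  show ?thesis unfolding variation_def
  proof (rule antisym)
    show "Sup ?V \<le> (\<Sum>x\<in>S \<inter> E. \<bar>c x\<bar>)"
      using mem by (intro cSup_least) (auto intro: upper)
    show "(\<Sum>x\<in>S \<inter> E. \<bar>c x\<bar>) \<le> Sup ?V"
      using mem le by (rule cSup_upper2) (auto intro!: bdd_aboveI upper)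
  qed
qed

lemma pos_part_atomic:
  assumes "t1_space X" "finite S" "S \<subseteq> topspace X" "E \<in> borel_sets X"
  shows "pos_part X (atomic_measure X S c) E = (\<Sum>x\<in>S \<inter> E. max (c x) 0)"
proof -
  have "pos_part X (atomic_measure X S c) E = (\<Sum>x\<in>S \<inter> E. (\<bar>c x\<bar> + c x) / 2)"
    unfolding pos_part_def variation_atomic[OF assms]
    using assms(4) by (simp add: atomic_measure_def sum.distrib flip: sum_divide_distrib)
  also have "\<dots> = (\<Sum>x\<in>S \<inter> E. max (c x) 0)" by (intro sum.cong) auto
  finally show ?thesis .
qed

lemma neg_part_atomic:
  assumes "t1_space X" "finite S" "S \<subseteq> topspace X" "E \<in> borel_sets X"
  shows "neg_part X (atomic_measure X S c) E = (\<Sum>x\<in>S \<inter> E. max (- c x) 0)"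
proof -
  have "neg_part X (atomic_measure X S c) E = (\<Sum>x\<in>S \<inter> E. (\<bar>c x\<bar> - c x) / 2)"
    unfolding neg_part_def variation_atomic[OF assms]
    using assms(4) by (simp add: atomic_measure_def sum_subtractf flip: sum_divide_distrib)
  also have "\<dots> = (\<Sum>x\<in>S \<inter> E. max (- c x) 0)" by (intro sum.cong) auto
  finally show ?thesis .
qed

text \<open>For regularity, \<open>E\<close> is squeezed between the finite, hence compact, set
  \<open>S \<inter> E\<close> and the open complement of the finite set \<open>S - E\<close>. No
  atom lies between the two, so the variation of the difference is 0.\<close>

lemma atomic_measure_in_measure_space_M:
  assumes t1: "t1_space X" and S: "finite S" "S \<subseteq> topspace X"
  shows "atomic_measure X S c \<in> measure_space_M X"
proof -
  have "regular_measure X (atomic_measure X S c)"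
    unfolding regular_measure_def
  proof (intro ballI allI impI)
    fix E and \<epsilon> :: real assume E: "E \<in> borel_sets X" and "\<epsilon> > 0"
    let ?C = "S \<inter> E" and ?U = "topspace X - (S - E)"
    have "closedin X (S - E)"
      using t1 S by (meson Diff_subset finite_Diff order_trans t1_space_closedin_finite)
    then have U: "openin X ?U" by blast
    have C: "compactin X ?C" using S by (intro finite_imp_compactin) auto
    have "?U - ?C \<in> borel_sets X"
      using S by (intro Diff_borel_sets openin_borel_sets[OF U] finite_borel_sets[OF t1]) auto
    moreover have "S \<inter> (?U - ?C) = {}" by auto
    ultimately have "variation X (atomic_measure X S c) (?U - ?C) = 0"
      by (metis (no_types) variation_atomic[OF t1 S] sum.empty)
    then show "\<exists>C U. compactin X C \<and> openin X U \<and> C \<subseteq> E \<and> E \<subseteq> U \<and>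
        variation X (atomic_measure X S c) (U - C) < \<epsilon>"
      using C U borel_sets_subset[OF E] \<open>\<epsilon> > 0\<close>
      by (intro exI[of _ ?C] exI[of _ ?U]) auto
  qed
  then show ?thesis
    using signed_borel_measure_atomic[OF S(1)]
    by (simp add: measure_space_M_def atomic_measure_def)
qed

text \<open>The measure is concentrated on \<open>S\<close>, so \<open>f\<close> equals almost
  everywhere a finite combination of indicators of singletons. Keeping \<open>m\<close> abstract
  lets one proof serve both Jordan parts.\<close>

lemma integral_atomic:
  fixes f :: "'a \<Rightarrow> real"
  assumes t1: "t1_space X" and S: "finite S" "S \<subseteq> topspace X"
    and d: "\<And>x. 0 \<le> d x" and f: "continuous_map X euclideanreal f"
    and m: "\<And>E. E \<in> borel_sets X \<Longrightarrow> m E = (\<Sum>x\<in>S \<inter> E. d x)"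
  shows "integral\<^sup>L (measure_of (topspace X) {U. openin X U} (\<lambda>E. ennreal (m E))) f
    = (\<Sum>x\<in>S. d x * f x)"
proof -
  define M where "M = measure_of (topspace X) {U. openin X U} (\<lambda>E. ennreal (m E))"
  have sets: "sets M = borel_sets X" and space: "space M = topspace X"
    unfolding M_def by (auto simp: sets_measure_of space_measure_of openin_subset_Pow)
  \<comment> \<open>\<open>measure_of\<close> falls back to the zero measure unless the given set
    function is a measure, so positivity and countable additivity have to be established
    first.\<close>
  have em: "emeasure M E = ennreal (\<Sum>x\<in>S \<inter> E. d x)" if E: "E \<in> borel_sets X" for E
  proof -
    have "emeasure M E = ennreal (m E)"
    proof (rule emeasure_measure_of[OF M_def openin_subset_Pow])
      show "positive (sets M) (\<lambda>E. ennreal (m E))"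
        by (simp add: positive_def m sigma_sets.Empty)
      show "countably_additive (sets M) (\<lambda>E. ennreal (m E))"
        unfolding countably_additive_def
      proof (intro allI impI)
        fix A :: "nat \<Rightarrow> 'a set"
        assume A: "range A \<subseteq> sets M" "disjoint_family A" "(\<Union>i. A i) \<in> sets M"
        have "A i \<in> borel_sets X" for i using A(1) sets by auto
        then show "(\<Sum>i. ennreal (m (A i))) = ennreal (m (\<Union>i. A i))"
          using atomic_measure_sums[OF S(1) A(2), of d] A(3)
          by (intro suminf_ennreal_eq) (auto simp: m sets sum_nonneg d)
      qed
    qed (use E sets in auto)
    then show ?thesis by (simp add: m E)
  qed
  have sing: "{x} \<in> sets M" if "x \<in> S" for x
    using finite_borel_sets[OF t1, of "{x}"] that S sets by auto
  have Smem: "S \<in> sets M" using finite_borel_sets[OF t1 S] sets by simp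
  have meas: "f \<in> borel_measurable M"
  proof (rule borel_measurableI)
    fix T :: "real set" assume "open T"
    then have "openin X {x \<in> topspace X. f x \<in> T}"
      using f by (simp add: continuous_map_def)
    then have "{x \<in> topspace X. f x \<in> T} \<in> sets M" by (simp add: openin_borel_sets sets)
    moreover have "{x \<in> topspace X. f x \<in> T} = f -` T \<inter> space M" by (auto simp: space)
    ultimately show "f -` T \<inter> space M \<in> sets M" by simp
  qed
  have "emeasure M (space M - S) = 0"
    using Diff_borel_sets[of "topspace X" X S] Smem
    by (simp add: em space sets sigma_sets_top Int_Diff)
  then have AE_S: "AE x in M. x \<in> S"
    using Smem by (intro AE_I[of _ _ "space M - S"]) auto
  have "integral\<^sup>L M f = integral\<^sup>L M (\<lambda>x. \<Sum>y\<in>S. f y * indicator {y} x)"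
  proof (rule integral_cong_AE)
    show "AE x in M. f x = (\<Sum>y\<in>S. f y * indicator {y} x)"
      using AE_S by eventually_elim (use S in \<open>simp add: indicator_def of_bool_def if_distrib cong: if_cong\<close>)
  qed (use meas sing in \<open>auto intro!: borel_measurable_sum\<close>)
  also have "\<dots> = (\<Sum>y\<in>S. f y * measure M {y})"
    using sing by (subst Bochner_Integration.integral_sum) (auto simp: em sets)
  also have "\<dots> = (\<Sum>x\<in>S. d x * f x)"
  proof (rule sum.cong)
    fix y assume "y \<in> S"
    then have "measure M {y} = d y"
      using sing sets by (simp add: measure_def em d)
    then show "f y * measure M {y} = d y * f y" by simp
  qed simp
  finally show ?thesis unfolding M_def .
qed

text \<open>Atom by atom, \<open>max (c x) 0 - max (- c x) 0 = c x\<close> recombines the two Jordan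
  parts.\<close>

lemma signed_integral_atomic:
  assumes "t1_space X" "finite S" "S \<subseteq> topspace X" "continuous_map X euclideanreal f"
  shows "signed_integral X (atomic_measure X S c) f = (\<Sum>x\<in>S. c x * f x)"
proof -
  have "signed_integral X (atomic_measure X S c) f
      = (\<Sum>x\<in>S. max (c x) 0 * f x) - (\<Sum>x\<in>S. max (- c x) 0 * f x)"
    unfolding signed_integral_def
    using integral_atomic[OF assms(1-3) _ assms(4), of "\<lambda>x. max (c x) 0"]
      integral_atomic[OF assms(1-3) _ assms(4), of "\<lambda>x. max (- c x) 0"]
    by (simp add: pos_part_atomic[OF assms(1-3)] neg_part_atomic[OF assms(1-3)])
  also have "\<dots> = (\<Sum>x\<in>S. c x * f x)"
    unfolding sum_subtractf[symmetric] by (intro sum.cong) (auto simp: max_def)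
  finally show ?thesis .
qed

section \<open>Finite additivity and the compensations of finitely supported measures\<close>

lemma signed_borel_measure_empty:
  assumes "signed_borel_measure X \<mu>"
  shows "\<mu> {} = 0"
proof -
  have "(\<lambda>i::nat. \<mu> {}) sums \<mu> {}"
    using assms[unfolded signed_borel_measure_def, rule_format, of "\<lambda>_. {}"]
    by (auto simp: sigma_sets.Empty disjoint_family_on_def)
  then show ?thesis by (auto dest: sums_summable simp: summable_const_iff)
qed

text \<open>Countable additivity is applied to the sequence \<open>A\<close>, \<open>B\<close>,
  \<open>{}\<close>, \<open>{}\<close>, and so on.\<close>

lemma signed_borel_measure_Un:
  assumes "signed_borel_measure X \<mu>" "A \<in> borel_sets X" "B \<in> borel_sets X" "A \<inter> B = {}"
  shows "\<mu> (A \<union> B) = \<mu> A + \<mu> B"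
proof -
  have "disjoint_family (binaryset A B)"
    using assms(4) by (auto simp: disjoint_family_on_def binaryset_def)
  moreover have "range (binaryset A B) \<subseteq> borel_sets X"
    using assms by (auto simp: range_binaryset_eq sigma_sets.Empty)
  ultimately have "(\<lambda>i. \<mu> (binaryset A B i)) sums \<mu> (A \<union> B)"
    using assms(1) by (metis (no_types) signed_borel_measure_def UN_binaryset_eq)
  then show ?thesis
    using binaryset_sums[of \<mu> A B] signed_borel_measure_empty[OF assms(1)] sums_unique2 by blast
qed

text \<open>Domination by the positive part leaves a compensation no mass off \<open>S\<close>, so
  its values on the singletons of \<open>S\<close> determine it. Positivity of
  \<open>sum c S\<close> selects the nontrivial case of the definition.\<close>

lemma compensation_atomic:
  assumes t1: "t1_space X" and S: "finite S" "S \<subseteq> topspace X" and pos: "sum c S > 0"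
    and comp: "is_compensation X \<nu> (atomic_measure X S c)"
  obtains d where "\<nu> = atomic_measure X S d" "\<And>x. x \<in> S \<Longrightarrow> 0 \<le> d x"
    "\<And>x. x \<in> S \<Longrightarrow> d x \<le> max (c x) 0" "sum d S = sum c S"
proof -
  have top: "topspace X \<in> borel_sets X" by (rule sigma_sets_top)
  have tot: "atomic_measure X S c (topspace X) = sum c S"
    using S(2) top by (simp add: atomic_measure_def Int_absorb2)
  have \<nu>: "\<nu> \<in> measure_space_M X" and \<nu>top: "\<nu> (topspace X) = sum c S"
    and le: "\<And>E. E \<in> borel_sets X \<Longrightarrow> 0 \<le> \<nu> E \<and> \<nu> E \<le> (\<Sum>x\<in>S \<inter> E. max (c x) 0)"
    using comp pos tot by (auto simp: is_compensation_def pos_part_atomic[OF t1 S])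
  have sb: "signed_borel_measure X \<nu>" and zero: "\<And>E. E \<notin> borel_sets X \<Longrightarrow> \<nu> E = 0"
    using \<nu> by (auto simp: measure_space_M_def)
  have sing: "{x} \<in> borel_sets X" if "x \<in> S" for x
    using finite_borel_sets[OF t1, of "{x}"] that S by auto
  have fin: "\<nu> T = (\<Sum>x\<in>T. \<nu> {x})" if "finite T" "T \<subseteq> S" for T
    using that
  proof (induction T)
    case empty
    then show ?case by (simp add: signed_borel_measure_empty[OF sb])
  next
    case (insert x T)
    then have "T \<in> borel_sets X" using S finite_borel_sets[OF t1, of T] by auto
    then show ?case
      using insert signed_borel_measure_Un[OF sb, of "{x}" T] sing by auto
  qed
  have eq: "\<nu> = atomic_measure X S (\<lambda>x. \<nu> {x})"
  proof
    fix E
    show "\<nu> E = atomic_measure X S (\<lambda>x. \<nu> {x}) E"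
    proof (cases "E \<in> borel_sets X")
      case True
      have ES: "E - S \<in> borel_sets X"
        by (rule Diff_borel_sets[OF True finite_borel_sets[OF t1 S]])
      have SE: "S \<inter> E \<in> borel_sets X" using S by (intro finite_borel_sets[OF t1]) auto
      have "S \<inter> (E - S) = {}" by auto
      \<comment> \<open>The upper bound on \<open>E - S\<close> is an empty sum, and the lower bound
        is 0.\<close>
      with le[OF ES] have "\<nu> (E - S) = 0" by simp
      moreover have "S \<inter> E \<union> (E - S) = E" "S \<inter> E \<inter> (E - S) = {}" by auto
      ultimately have "\<nu> E = \<nu> (S \<inter> E)"
        using signed_borel_measure_Un[OF sb SE ES] by simp
      then show ?thesis using fin[of "S \<inter> E"] S True by (simp add: atomic_measure_def)
    qed (simp add: atomic_measure_def zero)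
  qed
  show ?thesis
  proof
    show "\<nu> = atomic_measure X S (\<lambda>x. \<nu> {x})" by (rule eq)
    show "0 \<le> \<nu> {x}" "\<nu> {x} \<le> max (c x) 0" if "x \<in> S" for x
      using le[OF sing[OF that]] that by simp_all
    show "(\<Sum>x\<in>S. \<nu> {x}) = sum c S"
      using fun_cong[OF eq, of "topspace X"] \<nu>top S(2) top
      by (simp add: atomic_measure_def Int_absorb2)
  qed
qed

section \<open>Weak-star continuous maps\<close>

text \<open>Integration of \<open>f\<close> is one of the coordinates that generate the weak-star
  topology.\<close>

lemma continuous_signed_integral:
  assumes "G \<in> W X" "continuous_map X euclideanreal f"
  shows "continuous_map X euclideanreal (\<lambda>x. signed_integral X (G x) f)"
proof -
  have "continuous_map X (weak_star_topology X) G"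
    using assms(1) by (simp add: W_def continuous_map_in_subtopology)
  moreover have "continuous_map (weak_star_topology X) euclideanreal
      ((\<lambda>y. y f) \<circ> (\<lambda>\<mu>. \<lambda>f\<in>{f. continuous_map X euclideanreal f}. signed_integral X \<mu> f))"
    unfolding weak_star_topology_def
    using assms(2) by (intro continuous_map_pullback continuous_map_product_projection) simp
  ultimately show ?thesis
    using assms(2) by (auto dest: continuous_map_compose simp: comp_def)
qed

text \<open>This is the universal property of an initial topology: continuity into it is tested on
  the generating functionals.\<close>

lemma in_W_I:
  assumes "\<And>x. x \<in> topspace X \<Longrightarrow> F x \<in> unit_ball_M X"
    and "\<And>f. continuous_map X euclideanreal f \<Longrightarrow>
      continuous_map X euclideanreal (\<lambda>x. signed_integral X (F x) f)"
  shows "F \<in> W X"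
proof -
  have "continuous_map X (weak_star_topology X) F"
    unfolding weak_star_topology_def
    using assms
    by (intro continuous_map_pullback')
      (auto simp: continuous_map_componentwise unit_ball_M_def)
  then show ?thesis
    using assms(1) by (auto simp: W_def continuous_map_in_subtopology)
qed

text \<open>These are the weights of (delta_p + delta_q - delta_r) / 3. Contributions add up when
  points coincide, so q = r leaves delta_p / 3, with no separate case.\<close>

definition three_point_weight :: "'a \<Rightarrow> 'a \<Rightarrow> 'a \<Rightarrow> 'a \<Rightarrow> real" where
  "three_point_weight p q r y = (of_bool (y = p) + of_bool (y = q) - of_bool (y = r)) / 3"

lemma sum_three_point_weight:
  "(\<Sum>y\<in>{p, q, r}. three_point_weight p q r y * f y) = (f p + f q - f r) / 3"
proof -
  have weight: "three_point_weight p q r y * f y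
      = ((if y = p then f y else 0) + (if y = q then f y else 0) - (if y = r then f y else 0)) / 3" for y
    by (simp add: three_point_weight_def)
  \<comment> \<open>An abstract finite set \<open>T\<close> keeps the explicit set from being
    expanded into cases according to which points coincide.\<close>
  have "(\<Sum>y\<in>T. three_point_weight p q r y * f y) = (f p + f q - f r) / 3"
    if "finite T" "p \<in> T" "q \<in> T" "r \<in> T" for T
    unfolding weight using that
    by (simp add: sum.distrib sum_subtractf flip: sum_divide_distrib)
  then show ?thesis by simp
qed

definition three_point_map ::
    "'a topology \<Rightarrow> ('a \<Rightarrow> 'a) \<Rightarrow> ('a \<Rightarrow> 'a) \<Rightarrow> 'a \<Rightarrow> 'a \<Rightarrow> 'a set \<Rightarrow> real" where
  "three_point_map X P Q r x =
     atomic_measure X {P x, Q x, r} (three_point_weight (P x) (Q x) r)"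

text \<open>The factor 1/3 brings the variation of three unit masses down to at most 1. The integral
  of \<open>f\<close> is (f(P x) + f(Q x) - f(r)) / 3, which is continuous in
  \<open>x\<close>.\<close>

lemma three_point_map_in_W:
  assumes t1: "t1_space X" and P: "continuous_map X X P" and Q: "continuous_map X X Q"
    and r: "r \<in> topspace X"
  shows "three_point_map X P Q r \<in> W X"
proof (rule in_W_I)
  have S: "{P x, Q x, r} \<subseteq> topspace X" if "x \<in> topspace X" for x
    using continuous_map_image_subset_topspace[OF P] continuous_map_image_subset_topspace[OF Q]
      that r by auto
  show "three_point_map X P Q r x \<in> unit_ball_M X" if x: "x \<in> topspace X" for x
  proof -
    have "\<bar>three_point_weight p q r y\<bar>
        \<le> (of_bool (y = p) + of_bool (y = q) + of_bool (y = r)) / 3" for p q r y :: 'a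
      by (simp add: three_point_weight_def)
    then have "(\<Sum>y\<in>{P x, Q x, r}. \<bar>three_point_weight (P x) (Q x) r y\<bar>)
        \<le> (\<Sum>y\<in>{P x, Q x, r}. (of_bool (y = P x) + of_bool (y = Q x) + of_bool (y = r)) / 3)"
      by (intro sum_mono)
    also have "\<dots> = 1"
    proof -
      have "(\<Sum>y\<in>T. (of_bool (y = p) + of_bool (y = q) + of_bool (y = r)) / 3 :: real) = 1"
        if "finite T" "p \<in> T" "q \<in> T" "r \<in> T" for p q r :: 'a and T
        using that
        by (simp add: add_divide_distrib sum.distrib of_bool_def flip: sum_divide_distrib)
      then show ?thesis by simp
    qed
    finally show ?thesis
      using variation_atomic[OF t1 _ S[OF x] sigma_sets_top]
        atomic_measure_in_measure_space_M[OF t1 _ S[OF x]] S[OF x]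
      by (simp add: unit_ball_M_def three_point_map_def Int_absorb2 del: insert_subset sum.insert sum.insert_if)
  qed
  show "continuous_map X euclideanreal (\<lambda>x. signed_integral X (three_point_map X P Q r x) f)"
    if f: "continuous_map X euclideanreal f" for f
  proof (rule continuous_map_eq)
    have "continuous_map X euclideanreal (\<lambda>x. f (P x))" "continuous_map X euclideanreal (\<lambda>x. f (Q x))"
      using continuous_map_compose[OF P f] continuous_map_compose[OF Q f] by (simp_all add: comp_def)
    then show "continuous_map X euclideanreal (\<lambda>x. (f (P x) + f (Q x) - f r) / 3)"
      by (intro continuous_intros) auto
    show "(f (P x) + f (Q x) - f r) / 3 = signed_integral X (three_point_map X P Q r x) f"
      if "x \<in> topspace X" for x
      unfolding three_point_map_def
      by (subst signed_integral_atomic[OF t1 _ S[OF that] f]) (simp_all only: sum_three_point_weight, simp)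
  qed
qed

section \<open>Fort spaces\<close>

text \<open>For \<open>p\<close> in \<open>S\<close> this is the one-point compactification of the
  discrete space \<open>S - {p}\<close>, with \<open>p\<close> as the point at infinity.\<close>

definition fort_space :: "'a set \<Rightarrow> 'a \<Rightarrow> 'a topology" where
  "fort_space S p = topology (\<lambda>U. U \<subseteq> S \<and> (p \<in> U \<longrightarrow> finite (S - U)))"

lemma openin_fort_space: "openin (fort_space S p) U \<longleftrightarrow> U \<subseteq> S \<and> (p \<in> U \<longrightarrow> finite (S - U))"
proof -
  have "istopology (\<lambda>U. U \<subseteq> S \<and> (p \<in> U \<longrightarrow> finite (S - U)))"
    unfolding istopology_def
  proof (rule conjI; intro allI impI)
    fix A B assume "A \<subseteq> S \<and> (p \<in> A \<longrightarrow> finite (S - A))" "B \<subseteq> S \<and> (p \<in> B \<longrightarrow> finite (S - B))"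
    then show "A \<inter> B \<subseteq> S \<and> (p \<in> A \<inter> B \<longrightarrow> finite (S - A \<inter> B))"
      by (auto simp: Diff_Int)
  next
    fix \<K> assume K: "\<forall>A\<in>\<K>. A \<subseteq> S \<and> (p \<in> A \<longrightarrow> finite (S - A))"
    have "finite (S - \<Union>\<K>)" if "p \<in> \<Union>\<K>"
    proof -
      from that obtain A where "A \<in> \<K>" "p \<in> A" by auto
      then have "finite (S - A)" using K by auto
      then show ?thesis by (rule finite_subset[rotated]) (use \<open>A \<in> \<K>\<close> in auto)
    qed
    then show "\<Union>\<K> \<subseteq> S \<and> (p \<in> \<Union>\<K> \<longrightarrow> finite (S - \<Union>\<K>))"
      using K by auto
  qed
  then show ?thesis by (simp add: fort_space_def)
qed

lemma topspace_fort_space [simp]: "topspace (fort_space S p) = S"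
proof
  show "topspace (fort_space S p) \<subseteq> S"
    using openin_topspace[of "fort_space S p"] by (simp only: openin_fort_space)
  have "openin (fort_space S p) S" by (simp add: openin_fort_space)
  then show "S \<subseteq> topspace (fort_space S p)" by (rule openin_subset)
qed

text \<open>A member of the cover that contains \<open>p\<close> misses only finitely many
  points.\<close>

lemma compact_fort_space:
  assumes "p \<in> S"
  shows "compact_space (fort_space S p)"
  unfolding compact_space_alt
proof (intro allI impI)
  fix \<U> assume "(\<forall>U\<in>\<U>. openin (fort_space S p) U) \<and> topspace (fort_space S p) \<subseteq> \<Union>\<U>"
  then have op: "\<forall>U\<in>\<U>. openin (fort_space S p) U" and cov: "topspace (fort_space S p) \<subseteq> \<Union>\<U>"
    by auto
  then obtain U where U: "U \<in> \<U>" "p \<in> U" using assms by auto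
  then have fin: "finite (S - U)" using op by (simp add: openin_fort_space)
  obtain \<F> where "finite \<F>" "\<F> \<subseteq> \<U>" "S - U \<subseteq> \<Union>\<F>"
    using finite_subset_Union[OF fin, of \<U>] cov by auto
  then show "\<exists>\<F>. finite \<F> \<and> \<F> \<subseteq> \<U> \<and> topspace (fort_space S p) \<subseteq> \<Union>\<F>"
    using U by (intro exI[of _ "insert U \<F>"]) auto
qed

text \<open>Of two distinct points at least one differs from \<open>p\<close>; its singleton is
  clopen and separates them.\<close>

lemma Hausdorff_fort_space: "Hausdorff_space (fort_space S p)"
  unfolding Hausdorff_space_def
proof (intro allI impI)
  fix x y assume xy: "x \<in> topspace (fort_space S p) \<and> y \<in> topspace (fort_space S p) \<and> x \<noteq> y"
  show "\<exists>U V. openin (fort_space S p) U \<and> openin (fort_space S p) V \<and> x \<in> U \<and> y \<in> V \<and> disjnt U V"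
  proof (cases "x = p")
    case True
    then show ?thesis using xy
      by (intro exI[of _ "S - {y}"] exI[of _ "{y}"])
        (auto simp: openin_fort_space disjnt_def double_diff)
  next
    case False
    then show ?thesis using xy
      by (intro exI[of _ "{x}"] exI[of _ "S - {x}"])
        (auto simp: openin_fort_space disjnt_def double_diff)
  qed
qed

text \<open>The singleton of a point other than \<open>p\<close> is clopen.\<close>

lemma continuous_map_indicator_fort_space:
  assumes "a \<noteq> p"
  shows "continuous_map (fort_space S p) euclideanreal (indicator {a})"
proof -
  have "openin (fort_space S p) {x \<in> S. indicator {a} x \<in> U}" for U :: "real set"
  proof (cases "(0::real) \<in> U")
    case True
    then have "S - {x \<in> S. indicator {a} x \<in> U} \<subseteq> {a}" by (auto simp: indicator_def)
    then have "finite (S - {x \<in> S. indicator {a} x \<in> U})" by (rule finite_subset) simp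
    then show ?thesis by (auto simp: openin_fort_space)
  next
    case False
    then show ?thesis using assms by (auto simp: openin_fort_space indicator_def)
  qed
  then show ?thesis by (simp add: continuous_map_def)
qed

text \<open>The set where \<open>f\<close> exceeds \<open>c\<close> is an open neighbourhood of
  \<open>p\<close>, hence cofinite. In this form continuity at infinity enters the
  counterexample.\<close>

lemma fort_space_eventually_gt:
  assumes "continuous_map (fort_space S p) euclideanreal f" "p \<in> S" "f p > (c::real)"
  shows "finite {x \<in> S. f x \<le> c}"
proof -
  have "openin (fort_space S p) {x \<in> S. f x \<in> {c<..}}"
    using assms(1)[unfolded continuous_map_def topspace_fort_space, THEN conjunct2, rule_format, of "{c<..}"]
    by simp
  then have "finite (S - {x \<in> S. f x \<in> {c<..}})"
    using assms by (simp add: openin_fort_space)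
  moreover have "S - {x \<in> S. f x \<in> {c<..}} = {x \<in> S. f x \<le> c}" by auto
  ultimately show ?thesis by simp
qed

section \<open>The counterexample\<close>

text \<open>An encoding of the product of the two Fort spaces with coordinates indexed by the reals 0 and 1.\<close>

definition fort_product :: "(real \<Rightarrow> real) topology" where
  "fort_product = product_topology (\<lambda>i. fort_space (if i = 0 then \<nat> else UNIV) 0) {0, 1}"

text \<open>Points of a product topology are extensional functions, hence the restriction to
  \<open>{0, 1}\<close>. The value 0 stands for infinity in both coordinates; the isolated values
  are the positive naturals in the first and the nonzero reals in the second.\<close>

definition fort_point :: "real \<Rightarrow> real \<Rightarrow> real \<Rightarrow> real" where
  "fort_point a b = (\<lambda>i\<in>{0, 1}. if i = 0 then a else b)"

lemma fort_point_simps [simp]: "fort_point a b 0 = a" "fort_point a b 1 = b"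
  by (simp_all add: fort_point_def)

lemma fort_point_eq_iff [simp]: "fort_point a b = fort_point a' b' \<longleftrightarrow> a = a' \<and> b = b'"
  (is "?l \<longleftrightarrow> ?r")
proof
  assume ?l
  then have "fort_point a b 0 = fort_point a' b' 0" "fort_point a b 1 = fort_point a' b' 1"
    by (rule fun_cong)+
  then show ?r by simp
qed simp

lemma fort_point_in_topspace: "a \<in> \<nat> \<Longrightarrow> fort_point a b \<in> topspace fort_product"
  by (auto simp: fort_product_def fort_point_def)

lemma compact_fort_product: "compact_space fort_product"
  by (simp add: fort_product_def compact_space_product_topology compact_fort_space)

lemma Hausdorff_fort_product: "Hausdorff_space fort_product"
  by (simp add: fort_product_def Hausdorff_space_product_topology Hausdorff_fort_space)

lemma continuous_map_fort_coordinates: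
  shows "continuous_map fort_product (fort_space \<nat> 0) (\<lambda>x. x 0)"
    and "continuous_map fort_product (fort_space UNIV 0) (\<lambda>x. x 1)"
proof -
  have proj: "continuous_map fort_product (fort_space (if i = 0 then \<nat> else UNIV) 0) (\<lambda>x. x i)"
    if "i \<in> {0, 1}" for i
    unfolding fort_product_def by (rule continuous_map_product_projection[OF that])
  show "continuous_map fort_product (fort_space \<nat> 0) (\<lambda>x. x 0)" using proj[of 0] by simp
  show "continuous_map fort_product (fort_space UNIV 0) (\<lambda>x. x 1)" using proj[of 1] by simp
qed

lemma continuous_map_fort_point:
  assumes "continuous_map X (fort_space \<nat> 0) f" "continuous_map X (fort_space UNIV 0) g"
  shows "continuous_map X fort_product (\<lambda>x. fort_point (f x) (g x))"
  unfolding fort_product_def continuous_map_componentwise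
  using assms by (auto simp: fort_point_def)

lemma not_admits_local_compensation_fort_product: "\<not> admits_local_compensation fort_product"
proof
  let ?K = fort_product
  \<comment> \<open>\<open>P\<close> and \<open>Q\<close> retract onto the axes of points (a,oo) and
    (oo,b), and \<open>o'\<close> is (oo,oo).\<close>
  define P where "P = (\<lambda>x :: real \<Rightarrow> real. fort_point (x 0) 0)"
  define Q where "Q = (\<lambda>x :: real \<Rightarrow> real. fort_point 0 (x 1))"
  define o' where "o' = fort_point 0 0"
  define F where "F = three_point_map ?K P Q o'"
  have t1: "t1_space ?K" by (rule Hausdorff_imp_t1_space[OF Hausdorff_fort_product])
  have o': "o' \<in> topspace ?K" by (simp add: o'_def fort_point_in_topspace)
  have PQ: "continuous_map ?K ?K P" "continuous_map ?K ?K Q"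
    unfolding P_def Q_def by (intro continuous_map_fort_point continuous_map_fort_coordinates; simp)+
  have "F \<in> W ?K" unfolding F_def by (rule three_point_map_in_W[OF t1 PQ o'])
  moreover assume "admits_local_compensation ?K"
  ultimately obtain G where G: "G \<in> W ?K" and
      comp: "\<And>x. x \<in> topspace ?K \<Longrightarrow> is_compensation ?K (G x) (F x)"
    by (auto simp: admits_local_compensation_def)
  \<comment> \<open>These are the masses that \<open>G x\<close> gives to the slices with first
    coordinate \<open>n\<close> and with second coordinate \<open>b\<close>. For nonzero
    \<open>n\<close> and \<open>b\<close> the slices are clopen, so their indicators are admissible
    test functions. At x = (n,b) the only atoms in them are \<open>P x\<close> and
    \<open>Q x\<close> respectively.\<close>
  define \<alpha> where "\<alpha> = (\<lambda>n x. signed_integral ?K (G x) (\<lambda>y. indicator {n} (y 0)))"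
  define \<beta> where "\<beta> = (\<lambda>b x. signed_integral ?K (G x) (\<lambda>y. indicator {b} (y 1)))"
  have cont0: "continuous_map ?K euclideanreal (\<lambda>y. indicator {n} (y 0))" if "n \<noteq> 0" for n
    using continuous_map_compose[OF continuous_map_fort_coordinates(1)
        continuous_map_indicator_fort_space[OF that]] by (simp add: comp_def)
  have cont1: "continuous_map ?K euclideanreal (\<lambda>y. indicator {b} (y 1))" if "b \<noteq> 0" for b
    using continuous_map_compose[OF continuous_map_fort_coordinates(2)
        continuous_map_indicator_fort_space[OF that]] by (simp add: comp_def)
  have S: "{P x, Q x, o'} \<subseteq> topspace ?K" if "x \<in> topspace ?K" for x
    using continuous_map_image_subset_topspace[OF PQ(1)]
      continuous_map_image_subset_topspace[OF PQ(2)] that o' by auto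
  \<comment> \<open>The total mass of \<open>F x\<close> is (1 + 1 - 1) / 3 at every point, so the
    zero branch of the definition of compensation never occurs.\<close>
  have "\<exists>d. G x = atomic_measure ?K {P x, Q x, o'} d \<and>
      (\<forall>y\<in>{P x, Q x, o'}. 0 \<le> d y \<and> d y \<le> max (three_point_weight (P x) (Q x) o' y) 0) \<and>
      sum d {P x, Q x, o'} = 1 / 3" if x: "x \<in> topspace ?K" for x
  proof -
    have "(\<Sum>y\<in>{P x, Q x, o'}. three_point_weight (P x) (Q x) o' y) = (1 + 1 - 1) / 3"
      using sum_three_point_weight[of "P x" "Q x" o' "\<lambda>_. 1"] by (simp only: mult_1_right)
    also have "\<dots> = 1 / 3" by simp
    finally have tot: "sum (three_point_weight (P x) (Q x) o') {P x, Q x, o'} = 1 / 3" .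
    then have pos: "sum (three_point_weight (P x) (Q x) o') {P x, Q x, o'} > 0" by linarith
    show ?thesis
    proof (rule compensation_atomic[OF t1 _ S[OF x] pos comp[OF x, unfolded F_def three_point_map_def]])
      fix d assume "G x = atomic_measure ?K {P x, Q x, o'} d"
        "\<And>y. y \<in> {P x, Q x, o'} \<Longrightarrow> 0 \<le> d y"
        "\<And>y. y \<in> {P x, Q x, o'} \<Longrightarrow> d y \<le> max (three_point_weight (P x) (Q x) o' y) 0"
        "sum d {P x, Q x, o'} = sum (three_point_weight (P x) (Q x) o') {P x, Q x, o'}"
      then show ?thesis unfolding tot by (intro exI[of _ d] conjI ballI)
    qed simp
  qed
  then obtain D where D: "\<And>x. x \<in> topspace ?K \<Longrightarrow> G x = atomic_measure ?K {P x, Q x, o'} (D x) \<and>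
      (\<forall>y\<in>{P x, Q x, o'}. 0 \<le> D x y \<and> D x y \<le> max (three_point_weight (P x) (Q x) o' y) 0) \<and>
      sum (D x) {P x, Q x, o'} = 1 / 3"
    by metis
  have D_integral: "signed_integral ?K (G x) f = (\<Sum>y\<in>{P x, Q x, o'}. D x y * f y)"
    if "x \<in> topspace ?K" "continuous_map ?K euclideanreal f" for x f
    unfolding conjunct1[OF D[OF that(1)]]
    by (rule signed_integral_atomic[OF t1 _ S[OF that(1)] that(2)]) simp
  have D_sum: "sum (D x) {P x, Q x, o'} = 1 / 3" if "x \<in> topspace ?K" for x
    using D[OF that] by (elim conjE)
  \<comment> \<open>The weight of \<open>F x\<close> at \<open>o'\<close> is -1/3, or 0 when exactly
    one of \<open>P x\<close> and \<open>Q x\<close> equals \<open>o'\<close>; its positive part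
    vanishes.\<close>
  have D_o': "D x o' = 0" if "x \<in> topspace ?K" "P x \<noteq> o' \<or> Q x \<noteq> o'" for x
  proof -
    have "three_point_weight (P x) (Q x) o' o' \<le> 0" using that(2) by (auto simp: three_point_weight_def)
    moreover have "0 \<le> D x o' \<and> D x o' \<le> max (three_point_weight (P x) (Q x) o' o') 0"
      using D[OF that(1)] by simp
    ultimately show ?thesis by linarith
  qed
  have total: "\<alpha> n (fort_point n b) + \<beta> b (fort_point n b) = 1 / 3"
    if n: "n \<in> \<nat>" "n \<noteq> 0" and b: "b \<noteq> 0" for n b
  proof -
    note x = fort_point_in_topspace[OF n(1), of b]
    have "D (fort_point n b) o' = 0"
      using n b by (intro D_o'[OF x]) (simp add: P_def o'_def)
    then show ?thesis
      using D_integral[OF x cont0[OF n(2)]] D_integral[OF x cont1[OF b]] D_sum[OF x] n b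
      by (simp add: \<alpha>_def \<beta>_def P_def Q_def o'_def del: sum_mult_indicator)
  qed
  \<comment> \<open>At (n,oo) the point \<open>Q x\<close> merges with \<open>o'\<close>, which
    carries no mass, so all of 1/3 sits at (n,oo).\<close>
  have \<alpha>_limit: "\<alpha> n (fort_point n 0) = 1 / 3" if n: "n \<in> \<nat>" "n \<noteq> 0" for n
  proof -
    note x = fort_point_in_topspace[OF n(1), of 0]
    have "D (fort_point n 0) o' = 0"
      using n by (intro D_o'[OF x]) (simp add: P_def o'_def)
    then show ?thesis
      using D_integral[OF x cont0[OF n(2)]] D_sum[OF x] n
      by (simp add: \<alpha>_def P_def Q_def o'_def del: sum_mult_indicator)
  qed
  \<comment> \<open>Here \<open>P x\<close> merges with \<open>o'\<close>. The two copies are not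
    adjacent in the support set, so \<open>insert_commute\<close> brings them together.\<close>
  have \<beta>_limit: "\<beta> b (fort_point 0 b) = 1 / 3" if b: "b \<noteq> 0" for b
  proof -
    note x = fort_point_in_topspace[OF Nats_0, of b]
    have "D (fort_point 0 b) o' = 0"
      using b by (intro D_o'[OF x]) (simp add: Q_def o'_def)
    then show ?thesis
      using D_integral[OF x cont1[OF b]] D_sum[OF x] b
      by (simp add: insert_commute[of "fort_point 0 0" "fort_point 0 b"] \<beta>_def P_def Q_def o'_def del: sum_mult_indicator)
  qed
  \<comment> \<open>Along the line with first coordinate \<open>n\<close> the limit at infinity is
    1/3. The threshold 1/6 is half of the total mass, so \<open>\<alpha>\<close> and
    \<open>\<beta>\<close> cannot both exceed it at one point (n,b).\<close>
  have \<alpha>_small: "finite {b. \<alpha> n (fort_point n b) \<le> 1 / 6}" if n: "n \<in> \<nat>" "n \<noteq> 0" for n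
  proof -
    have "continuous_map (fort_space UNIV 0) ?K (\<lambda>b. fort_point n b)"
      using n by (intro continuous_map_fort_point) auto
    then have "continuous_map (fort_space UNIV 0) euclideanreal (\<lambda>b. \<alpha> n (fort_point n b))"
      using continuous_map_compose[OF _ continuous_signed_integral[OF G cont0[OF n(2)]]]
      by (simp add: \<alpha>_def comp_def)
    from fort_space_eventually_gt[OF this, of "1 / 6"] show ?thesis
      using \<alpha>_limit[OF n] by simp
  qed
  have \<beta>_small: "finite {n \<in> \<nat>. \<beta> b (fort_point n b) \<le> 1 / 6}" if b: "b \<noteq> 0" for b
  proof -
    have "continuous_map (fort_space \<nat> 0) ?K (\<lambda>n. fort_point n b)"
      by (intro continuous_map_fort_point) auto
    then have "continuous_map (fort_space \<nat> 0) euclideanreal (\<lambda>n. \<beta> b (fort_point n b))"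
      using continuous_map_compose[OF _ continuous_signed_integral[OF G cont1[OF b]]]
      by (simp add: \<beta>_def comp_def)
    from fort_space_eventually_gt[OF this, of "1 / 6"] show ?thesis
      using \<beta>_limit[OF b] by simp
  qed
  \<comment> \<open>The exceptional \<open>b\<close> form a countable union of finite sets. Adding 0
    ensures that the real chosen outside is not the point at infinity.\<close>
  have "countable (insert 0 (\<Union>n\<in>\<nat> - {0}. {b. \<alpha> n (fort_point n b) \<le> 1 / 6}))"
  proof (intro countable_insert countable_UN)
    show "countable (\<nat> - {0::real})" by (auto simp: Nats_def)
    show "countable {b. \<alpha> n (fort_point n b) \<le> 1 / 6}" if "n \<in> \<nat> - {0}" for n
      using \<alpha>_small[of n] that by (intro countable_finite) auto
  qed
  then have "insert 0 (\<Union>n\<in>\<nat> - {0}. {b. \<alpha> n (fort_point n b) \<le> 1 / 6}) \<noteq> UNIV"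
    using uncountable_UNIV_real by (intro notI) (simp only: simp_thms)
  then obtain b where "b \<notin> insert 0 (\<Union>n\<in>\<nat> - {0}. {b. \<alpha> n (fort_point n b) \<le> 1 / 6})"
    by blast
  then have "b \<noteq> 0" and b: "\<And>n. n \<in> \<nat> - {0} \<Longrightarrow> \<alpha> n (fort_point n b) > 1 / 6"
    by (simp_all add: not_le)
  \<comment> \<open>For this single \<open>b\<close> the mass \<open>\<beta>\<close> stays below the
    threshold at every positive natural, whereas \<open>\<beta>_small\<close> allows only finitely
    many.\<close>
  have "\<nat> - {0} \<subseteq> {n \<in> \<nat>. \<beta> b (fort_point n b) \<le> 1 / 6}"
  proof
    fix n :: real assume n: "n \<in> \<nat> - {0}"
    then have "\<alpha> n (fort_point n b) + \<beta> b (fort_point n b) = 1 / 3"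
      using total[of n b] \<open>b \<noteq> 0\<close> by simp
    with b[OF n] have "\<beta> b (fort_point n b) \<le> 1 / 6" by linarith
    then show "n \<in> {n \<in> \<nat>. \<beta> b (fort_point n b) \<le> 1 / 6}" using n by simp
  qed
  then have "finite (\<nat> - {0::real})"
    by (rule finite_subset[OF _ \<beta>_small[OF \<open>b \<noteq> 0\<close>]])
  moreover have "infinite (\<nat> :: real set)"
    unfolding Nats_def by (rule range_inj_infinite[OF inj_of_nat])
  ultimately show False by simp
qed

theorem mainTheorem9:
  shows "\<exists>X :: (real \<Rightarrow> real) topology.
           compact_space X \<and> Hausdorff_space X \<and> \<not> admits_local_compensation X"
  using compact_fort_product Hausdorff_fort_product not_admits_local_compensation_fort_product
  by blast

end
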